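(* Let $X$ be any set, and consider the hyperspace of finite subsets $2^{X_d}_f\subset 2^{X_d}_u$ with the upper semifinite topology. The Alexandroff extension of $2^{X_d}_f$ is homeomorphic to an inverse limit of an inverse system of finite topological spaces (indexed by a directed set, with continuous bonding maps).
   Context: For a set $X$, let $X_d$ be $X$ with the discrete topology. $2^{X_d}_u$ denotes the set of all non-empty subsets of $X$ with the upper semifinite topology, i.e. the topology generated by the base of sets $B(U)=\{C\subseteq X: C\neq\emptyset,\ C\subseteq U\}$, $U\subseteq X$. $2^{X_d}_f\subset 2^{X_d}_u$ is the subspace of finite non-empty subsets of $X$, with the subspace topology. The Alexandroff extension (one-point compactification) of an arbitrary topological space $Z$ is the set $Z^*=Z\cup\{\infty\}$, with $\infty\notin Z$, whose open sets are the open sets of $Z$ together with the subsets $U\subseteq Z^*$ containing $\infty$ such that $Z^*\setminus U$ is a closed and compact subset of $Z$ (compact does not include Hausdorff). *)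

theory Defs
  imports "HOL-Analysis.Analysis"
begin

definition nonempty_subsets :: "'a set \<Rightarrow> 'a set set" where
  "nonempty_subsets U = {C. C \<noteq> {} \<and> C \<subseteq> U}"

text \<open>As \<open>X\<close> is discrete, \<open>U\<close> ranges over all subsets of \<open>X\<close>, and the points of the hyperspace
  are all non-empty subsets of \<open>X\<close>. The generating family is a base, see
  \<open>openin_upper_semifinite\<close> below.\<close>

definition upper_semifinite :: "'a set \<Rightarrow> 'a set topology" where
  "upper_semifinite X = topology_generated_by {nonempty_subsets U | U. U \<subseteq> X}"

definition finite_hyperspace :: "'a set \<Rightarrow> 'a set topology" where
  "finite_hyperspace X = subtopology (upper_semifinite X) {C. finite C}"

text \<open>A directed set is a non-empty preordered set in which any two elements have an upper bound;
  \<open>(i, j) \<in> r\<close> means \<open>i \<le> j\<close>.\<close>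

definition directed_set :: "'i set \<Rightarrow> 'i rel \<Rightarrow> bool" where
  "directed_set I r \<longleftrightarrow>
     I \<noteq> {} \<and> preorder_on I r \<and> (\<forall>i\<in>I. \<forall>j\<in>I. \<exists>k\<in>I. (i, k) \<in> r \<and> (j, k) \<in> r)"

text \<open>The bonding map \<open>p i j\<close>, for \<open>i \<le> j\<close>, goes from \<open>T j\<close> to \<open>T i\<close>.\<close>

definition inverse_system ::
  "'i set \<Rightarrow> 'i rel \<Rightarrow> ('i \<Rightarrow> 'b topology) \<Rightarrow> ('i \<Rightarrow> 'i \<Rightarrow> 'b \<Rightarrow> 'b) \<Rightarrow> bool" where
  "inverse_system I r T p \<longleftrightarrow>
     directed_set I r \<and>
     (\<forall>i j. (i, j) \<in> r \<longrightarrow> continuous_map (T j) (T i) (p i j)) \<and>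
     (\<forall>i\<in>I. \<forall>x\<in>topspace (T i). p i i x = x) \<and>
     (\<forall>i j k. (i, j) \<in> r \<longrightarrow> (j, k) \<in> r \<longrightarrow> (\<forall>x\<in>topspace (T k). p i j (p j k x) = p i k x))"

definition inverse_limit ::
  "'i set \<Rightarrow> 'i rel \<Rightarrow> ('i \<Rightarrow> 'b topology) \<Rightarrow> ('i \<Rightarrow> 'i \<Rightarrow> 'b \<Rightarrow> 'b) \<Rightarrow> ('i \<Rightarrow> 'b) topology" where
  "inverse_limit I r T p =
     subtopology (product_topology T I) {x. \<forall>i j. (i, j) \<in> r \<longrightarrow> p i j (x j) = x i}"

lemma openin_upper_semifinite:
  "openin (upper_semifinite X) W \<longleftrightarrow>
     (\<exists>\<U>. (\<forall>U\<in>\<U>. U \<subseteq> X) \<and> W = (\<Union>U\<in>\<U>. nonempty_subsets U))"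
  (is "_ \<longleftrightarrow> ?base W")
proof
  assume "openin (upper_semifinite X) W"
  then have "generate_topology_on {nonempty_subsets U | U. U \<subseteq> X} W"
    by (simp add: upper_semifinite_def openin_topology_generated_by_iff)
  then show "?base W"
  proof induction
    case Empty
    show ?case by (rule exI[of _ "{}"]) simp
  next
    case (Int a b)
    then obtain \<A> \<B> where AB: "\<forall>U\<in>\<A>. U \<subseteq> X" "a = (\<Union>U\<in>\<A>. nonempty_subsets U)"
      "\<forall>U\<in>\<B>. U \<subseteq> X" "b = (\<Union>U\<in>\<B>. nonempty_subsets U)" by blast
    have "a \<inter> b = (\<Union>U\<in>(\<lambda>(A, B). A \<inter> B) ` (\<A> \<times> \<B>). nonempty_subsets U)"
      unfolding AB(2,4) by (force simp: nonempty_subsets_def)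
    moreover have "\<forall>U\<in>(\<lambda>(A, B). A \<inter> B) ` (\<A> \<times> \<B>). U \<subseteq> X" using AB(1) by auto
    ultimately show ?case by blast
  next
    case (UN K)
    then obtain F where F: "\<And>k. k \<in> K \<Longrightarrow> (\<forall>U\<in>F k. U \<subseteq> X) \<and> k = (\<Union>U\<in>F k. nonempty_subsets U)"
      by metis
    then have "\<Union>K = (\<Union>U\<in>\<Union>(F ` K). nonempty_subsets U)" by fastforce
    moreover have "\<forall>U\<in>\<Union>(F ` K). U \<subseteq> X" using F by blast
    ultimately show ?case by blast
  next
    case (Basis s)
    then obtain U where "U \<subseteq> X" "s = nonempty_subsets U" by blast
    then show ?case by (intro exI[of _ "{U}"]) simp
  qed
next
  assume "?base W"
  then obtain \<U> where U: "\<forall>U\<in>\<U>. U \<subseteq> X" "W = (\<Union>U\<in>\<U>. nonempty_subsets U)" by blast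
  have "openin (upper_semifinite X) (nonempty_subsets U)" if "U \<in> \<U>" for U
    unfolding upper_semifinite_def using U(1) that by (intro topology_generated_by_Basis) blast
  then show "openin (upper_semifinite X) W"
    unfolding U(2) by (intro openin_Union) blast
qed

lemma topspace_upper_semifinite: "topspace (upper_semifinite X) = nonempty_subsets X"
  by (auto simp: upper_semifinite_def topology_generated_by_topspace nonempty_subsets_def)

lemma topspace_finite_hyperspace:
  "topspace (finite_hyperspace X) = {C. C \<noteq> {} \<and> C \<subseteq> X \<and> finite C}"
  by (auto simp: finite_hyperspace_def topspace_upper_semifinite nonempty_subsets_def)

end

theory Submission
  imports Defs
begin

text \<open>
  For a finite set \<open>A \<subseteq> X\<close> let \<open>q\<^sub>A\<close> keep the non-empty subsets of \<open>A\<close> and send every other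
  point of the Alexandroff extension \<open>Y\<close>, including \<open>\<infinity>\<close>, to \<open>\<infinity>\<close>. The image of \<open>q\<^sub>A\<close> is finite;
  it gets the quotient topology of \<open>Y\<close>. Because \<open>q\<^sub>A \<circ> q\<^sub>B = q\<^sub>A\<close> for \<open>A \<subseteq> B\<close>, the maps \<open>q\<^sub>A\<close> themselves
  serve as bonding maps, and the \<open>q\<^sub>A\<close> form a cone from \<open>Y\<close> into the resulting inverse system.

  The cone map from \<open>Y\<close> to the limit is a homeomorphism. A thread with some coordinate \<open>C \<noteq> \<infinity>\<close> is
  the thread of \<open>C\<close>: every later coordinate must be \<open>C\<close> as well, and later coordinates determine all
  others. The only other thread is constantly \<open>\<infinity>\<close>, so the map is onto. It is injective because \<open>C\<close> is
  the only point that \<open>q\<^sub>C\<close> sends to \<open>C\<close>. What remains is that every open set \<open>U\<close> of \<open>Y\<close> is a union of preimages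
  of open sets of the finite quotients. If \<open>\<infinity> \<notin> U\<close>, then \<open>U\<close> is closed under passing to non-empty
  subsets, and the subsets of any \<open>C \<in> U\<close> form such a preimage, under \<open>q\<^sub>C\<close>. If \<open>\<infinity> \<in> U\<close>, then the
  complement \<open>K\<close> of \<open>U\<close> is a compact family of finite sets. It is covered by the neighbourhoods
  consisting of the non-empty subsets of one member of \<open>K\<close>, and finitely many of these, each
  finite, suffice: \<open>K\<close> is finite. So \<open>A = \<Union>K\<close> is an index, and since \<open>q\<^sub>A\<close> does not identify any
  point of \<open>K\<close> with another point, \<open>U\<close> is the preimage of \<open>q\<^sub>A(U)\<close>.

  Taking quotients of \<open>Y\<close>, instead of writing down finite topologies, covers both finite \<open>X\<close>
  (where \<open>\<infinity>\<close> is isolated) and infinite \<open>X\<close> (where the whole space is its only neighbourhood).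
\<close>

section \<open>Quotient topologies\<close>

definition quotient_topology :: "'a topology \<Rightarrow> ('a \<Rightarrow> 'b) \<Rightarrow> 'b topology" where
  "quotient_topology Y f =
     topology (\<lambda>W. W \<subseteq> f ` topspace Y \<and> openin Y {y \<in> topspace Y. f y \<in> W})"

lemma openin_quotient_topology:
  "openin (quotient_topology Y f) W \<longleftrightarrow>
     W \<subseteq> f ` topspace Y \<and> openin Y {y \<in> topspace Y. f y \<in> W}"
proof -
  have "openin Y {y \<in> topspace Y. f y \<in> S \<inter> T}"
    if "openin Y {y \<in> topspace Y. f y \<in> S}" "openin Y {y \<in> topspace Y. f y \<in> T}" for S T
  proof -
    have "{y \<in> topspace Y. f y \<in> S \<inter> T} =
        {y \<in> topspace Y. f y \<in> S} \<inter> {y \<in> topspace Y. f y \<in> T}" by blast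
    then show ?thesis using that by (simp only: openin_Int)
  qed
  moreover have "openin Y {y \<in> topspace Y. f y \<in> \<Union>\<K>}"
    if "\<And>S. S \<in> \<K> \<Longrightarrow> openin Y {y \<in> topspace Y. f y \<in> S}" for \<K>
  proof -
    have "{y \<in> topspace Y. f y \<in> \<Union>\<K>} = (\<Union>S\<in>\<K>. {y \<in> topspace Y. f y \<in> S})" by blast
    moreover have "openin Y (\<Union>S\<in>\<K>. {y \<in> topspace Y. f y \<in> S})"
      using that by (intro openin_Union) blast
    ultimately show ?thesis by (simp only:)
  qed
  ultimately have "istopology (\<lambda>W. W \<subseteq> f ` topspace Y \<and> openin Y {y \<in> topspace Y. f y \<in> W})"
    unfolding istopology_def by (intro conjI allI impI) (blast | simp only:)+
  then show ?thesis
    unfolding quotient_topology_def by (subst topology_inverse') simp_all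
qed

lemma topspace_quotient_topology: "topspace (quotient_topology Y f) = f ` topspace Y"
proof
  show "topspace (quotient_topology Y f) \<subseteq> f ` topspace Y"
    using openin_topspace[of "quotient_topology Y f"] unfolding openin_quotient_topology ..
  have "{y \<in> topspace Y. f y \<in> f ` topspace Y} = topspace Y" by blast
  then show "f ` topspace Y \<subseteq> topspace (quotient_topology Y f)"
    by (intro openin_subset) (simp add: openin_quotient_topology)
qed

lemma quotient_map_quotient_topology: "quotient_map Y (quotient_topology Y f) f"
  by (auto simp: quotient_map_def topspace_quotient_topology openin_quotient_topology)

section \<open>Recognising an inverse limit\<close>

text \<open>A cone of continuous maps exhibits its vertex as the inverse limit once it is bijective onto
  the threads and the vertex carries the initial topology. Over a directed set the preimages
  under single maps \<open>q i\<close> already form a base of the initial topology, which is why the last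
  hypothesis is stated without finite intersections.\<close>

lemma homeomorphic_map_inverse_limit:
  assumes sub: "r \<subseteq> I \<times> I"
    and cont: "\<And>i. i \<in> I \<Longrightarrow> continuous_map Y (T i) (q i)"
    and cone: "\<And>i j y. (i, j) \<in> r \<Longrightarrow> y \<in> topspace Y \<Longrightarrow> p i j (q j y) = q i y"
    and surj: "\<And>x. x \<in> topspace (inverse_limit I r T p) \<Longrightarrow>
                 \<exists>y\<in>topspace Y. \<forall>i\<in>I. q i y = x i"
    and inj: "\<And>y z. y \<in> topspace Y \<Longrightarrow> z \<in> topspace Y \<Longrightarrow> (\<And>i. i \<in> I \<Longrightarrow> q i y = q i z) \<Longrightarrow> y = z"
    and base: "\<And>U y. openin Y U \<Longrightarrow> y \<in> U \<Longrightarrow>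
                 \<exists>i\<in>I. \<exists>W. openin (T i) W \<and> q i y \<in> W \<and> {z \<in> topspace Y. q i z \<in> W} \<subseteq> U"
  shows "homeomorphic_map Y (inverse_limit I r T p) (\<lambda>y. \<lambda>i\<in>I. q i y)"
    (is "homeomorphic_map Y ?L ?f")
proof (rule bijective_open_imp_homeomorphic_map)
  have thread: "?f y \<in> {x. \<forall>i j. (i, j) \<in> r \<longrightarrow> p i j (x j) = x i}" if "y \<in> topspace Y" for y
    using sub cone that by auto
  show cf: "continuous_map Y ?L ?f"
    unfolding inverse_limit_def
    using cont thread by (simp add: continuous_map_in_subtopology continuous_map_componentwise
        image_subset_iff Pi_iff cong: restrict_cong)
  show img: "?f ` topspace Y = topspace ?L"
  proof
    show "?f ` topspace Y \<subseteq> topspace ?L"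
      using cf by (simp add: continuous_map_image_subset_topspace)
    show "topspace ?L \<subseteq> ?f ` topspace Y"
    proof
      fix x assume x: "x \<in> topspace ?L"
      then obtain y where y: "y \<in> topspace Y" "\<forall>i\<in>I. q i y = x i" using surj by blast
      from x have "x \<in> extensional I"
        by (auto simp: inverse_limit_def PiE_def)
      then have "x = ?f y" using y(2) by (intro extensionalityI[of _ I]) auto
      then show "x \<in> ?f ` topspace Y" using y(1) by blast
    qed
  qed
  show "inj_on ?f (topspace Y)"
  proof (rule inj_onI)
    fix y z assume yz: "y \<in> topspace Y" "z \<in> topspace Y" "?f y = ?f z"
    then have "q i y = q i z" if "i \<in> I" for i using that by (metis restrict_apply')
    then show "y = z" using inj yz by blast
  qed
  show "open_map Y ?L ?f"
    unfolding open_map_def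
  proof (intro allI impI)
    fix U assume U: "openin Y U"
    show "openin ?L (?f ` U)"
    proof (subst openin_subopen, intro ballI)
      fix x assume "x \<in> ?f ` U"
      then obtain y where y: "y \<in> U" "x = ?f y" by blast
      then obtain i W where W: "i \<in> I" "openin (T i) W" "q i y \<in> W"
          "{z \<in> topspace Y. q i z \<in> W} \<subseteq> U"
        using base[OF U] by blast
      have "continuous_map ?L (T i) (\<lambda>x. x i)"
        unfolding inverse_limit_def
        using W(1) by (intro continuous_map_from_subtopology continuous_map_product_projection)
      then have "openin ?L {x \<in> topspace ?L. x i \<in> W}"
        using W(2) by (rule openin_continuous_map_preimage)
      moreover have "x \<in> {x \<in> topspace ?L. x i \<in> W}"
        using y W img openin_subset[OF U] by auto
      moreover have "{x \<in> topspace ?L. x i \<in> W} \<subseteq> ?f ` U"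
        using W img[symmetric] by auto
      ultimately show "\<exists>V. openin ?L V \<and> x \<in> V \<and> V \<subseteq> ?f ` U" by blast
    qed
  qed
qed

section \<open>The hyperspace of finite subsets\<close>

lemma openin_finite_hyperspace_subsets:
  assumes "A \<subseteq> X" "finite A"
  shows "openin (finite_hyperspace X) (nonempty_subsets A)"
proof -
  have "openin (upper_semifinite X) (nonempty_subsets A)"
    unfolding openin_upper_semifinite using assms(1) by (intro exI[of _ "{A}"]) simp
  moreover have "nonempty_subsets A = nonempty_subsets A \<inter> {C. finite C}"
    using assms finite_subset by (auto simp: nonempty_subsets_def)
  ultimately show ?thesis
    unfolding finite_hyperspace_def openin_subtopology by blast
qed

lemma openin_finite_hyperspace_downward_closed:
  assumes "openin (finite_hyperspace X) V" "C \<in> V" "D \<noteq> {}" "D \<subseteq> C"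
  shows "D \<in> V"
proof -
  obtain \<U> where V: "V = (\<Union>U\<in>\<U>. nonempty_subsets U) \<inter> {C. finite C}"
    using assms(1) unfolding finite_hyperspace_def openin_subtopology openin_upper_semifinite by blast
  then obtain U where "U \<in> \<U>" "C \<in> nonempty_subsets U" "finite C" using assms(2) by blast
  then have "D \<in> nonempty_subsets U" "finite D"
    using assms(3,4) finite_subset by (auto simp: nonempty_subsets_def)
  then show ?thesis using V \<open>U \<in> \<U>\<close> by blast
qed

text \<open>A member of \<open>K\<close> has a smallest neighbourhood, its non-empty subsets, and this is a
  finite family.\<close>

lemma compactin_finite_hyperspace_imp_finite:
  assumes "compactin (finite_hyperspace X) K"
  shows "finite K"
proof -
  have K: "C \<noteq> {} \<and> C \<subseteq> X \<and> finite C" if "C \<in> K" for C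
    using compactin_subset_topspace[OF assms] that by (auto simp: topspace_finite_hyperspace)
  have "\<exists>\<F>. finite \<F> \<and> \<F> \<subseteq> nonempty_subsets ` K \<and> K \<subseteq> \<Union>\<F>"
  proof (rule compactinD[OF assms])
    show "openin (finite_hyperspace X) U" if "U \<in> nonempty_subsets ` K" for U
      using that K openin_finite_hyperspace_subsets by blast
    show "K \<subseteq> \<Union>(nonempty_subsets ` K)"
      using K by (auto simp: nonempty_subsets_def)
  qed
  then obtain \<F> where F: "finite \<F>" "\<F> \<subseteq> nonempty_subsets ` K" "K \<subseteq> \<Union>\<F>" by blast
  have "finite (nonempty_subsets C)" if "C \<in> K" for C
    using K[OF that] by (auto simp: nonempty_subsets_def intro: finite_subset[of _ "Pow C"])
  then have "finite (\<Union>\<F>)" using F by (intro finite_Union) auto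
  then show ?thesis using F(3) finite_subset by blast
qed

section \<open>Truncation to the subsets of a finite set\<close>

definition truncate :: "'a set \<Rightarrow> 'a set option \<Rightarrow> 'a set option" where
  "truncate A z = (case z of None \<Rightarrow> None | Some C \<Rightarrow> if C \<subseteq> A then Some C else None)"

lemma truncate_None [simp]: "truncate A None = None"
  by (simp add: truncate_def)

lemma truncate_Some: "truncate A (Some C) = (if C \<subseteq> A then Some C else None)"
  by (simp add: truncate_def)

lemma truncate_eq_Some_iff: "truncate A z = Some C \<longleftrightarrow> z = Some C \<and> C \<subseteq> A"
  by (auto simp: truncate_def split: option.split)

lemma truncate_truncate: "A \<subseteq> B \<Longrightarrow> truncate A (truncate B z) = truncate A z"
  by (auto simp: truncate_def split: option.split)

text \<open>The quotients by truncations determine the topology of the Alexandroff extension. For \<open>y = C\<close>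
  in an open set without \<open>\<infinity>\<close>, truncation at \<open>C\<close> suffices; if \<open>U\<close> contains \<open>\<infinity>\<close>, truncation at the
  union of the finitely many sets outside \<open>U\<close> works for every point of \<open>U\<close> at once.\<close>

lemma open_nbhd_from_truncation:
  fixes X :: "'a set"
  defines "Y \<equiv> Alexandroff_compactification (finite_hyperspace X)"
  assumes U: "openin Y U" "y \<in> U"
  obtains A W where "finite A" "A \<subseteq> X" "openin (quotient_topology Y (truncate A)) W"
    "truncate A y \<in> W" "{z \<in> topspace Y. truncate A z \<in> W} \<subseteq> U"
proof -
  from U(1) consider V where "openin (finite_hyperspace X) V" "U = Some ` V"
    | K where "compactin (finite_hyperspace X) K"
        "U = insert None (Some ` (topspace (finite_hyperspace X) - K))"
    unfolding Y_def openin_Alexandroff_compactification Alexandroff_open_iff by blast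
  then show ?thesis
  proof cases
    case 1
    then obtain C where C: "C \<in> V" "y = Some C" using U(2) by blast
    then have CX: "C \<noteq> {}" "C \<subseteq> X" "finite C"
      using openin_subset[OF 1(1)] by (auto simp: topspace_finite_hyperspace)
    let ?W = "Some ` nonempty_subsets C"
    have sub: "?W \<subseteq> topspace Y"
      using CX by (auto simp: Y_def topspace_Alexandroff_compactification
          topspace_finite_hyperspace nonempty_subsets_def dest: finite_subset)
    have pre: "{z \<in> topspace Y. truncate C z \<in> ?W} = ?W"
    proof (intro set_eqI iffI)
      fix z assume "z \<in> {z \<in> topspace Y. truncate C z \<in> ?W}"
      then obtain D where "truncate C z = Some D" "D \<in> nonempty_subsets C" by blast
      then show "z \<in> ?W" by (simp add: truncate_eq_Some_iff)
    next
      fix z assume "z \<in> ?W"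
      then show "z \<in> {z \<in> topspace Y. truncate C z \<in> ?W}"
        using sub by (auto simp: truncate_Some nonempty_subsets_def)
    qed
    have "openin Y ?W"
      unfolding Y_def openin_Alexandroff_compactification
      using openin_finite_hyperspace_subsets[OF CX(2,3)] by blast
    moreover have "?W \<subseteq> truncate C ` topspace Y"
    proof
      fix w assume w: "w \<in> ?W"
      then have "truncate C w = w" by (auto simp: truncate_Some nonempty_subsets_def)
      then show "w \<in> truncate C ` topspace Y" using w sub by (metis imageI subsetD)
    qed
    ultimately have "openin (quotient_topology Y (truncate C)) ?W"
      by (simp add: openin_quotient_topology pre)
    moreover have "truncate C y \<in> ?W"
      using C(2) CX(1) by (simp add: truncate_Some nonempty_subsets_def)
    moreover have "{z \<in> topspace Y. truncate C z \<in> ?W} \<subseteq> U"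
    proof -
      have "nonempty_subsets C \<subseteq> V"
        using openin_finite_hyperspace_downward_closed[OF 1(1) C(1)]
        by (auto simp: nonempty_subsets_def)
      then show ?thesis unfolding pre 1(2) by (rule image_mono)
    qed
    ultimately show ?thesis by (rule that[OF CX(3,2)])
  next
    case 2
    define A where "A = \<Union>K"
    have K: "C \<subseteq> X \<and> finite C" if "C \<in> K" for C
      using compactin_subset_topspace[OF 2(1)] that by (auto simp: topspace_finite_hyperspace)
    then have A: "finite A" "A \<subseteq> X"
      using compactin_finite_hyperspace_imp_finite[OF 2(1)] by (auto simp: A_def)
    have UY: "U \<subseteq> topspace Y" using U(1) by (rule openin_subset)
    \<comment> \<open>Points outside \<open>U\<close> are subsets of \<open>A\<close>, hence alone in their fibre of the truncation.\<close>
    have pre: "{z \<in> topspace Y. truncate A z \<in> truncate A ` U} = U"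
    proof
      show "{z \<in> topspace Y. truncate A z \<in> truncate A ` U} \<subseteq> U"
      proof (rule subsetI, rule ccontr)
        fix z assume z: "z \<in> {z \<in> topspace Y. truncate A z \<in> truncate A ` U}" "z \<notin> U"
        then obtain D where D: "z = Some D" "D \<in> K"
          by (auto simp: 2(2) Y_def topspace_Alexandroff_compactification)
        then have "truncate A z = Some D" by (auto simp: truncate_Some A_def)
        moreover obtain u where "u \<in> U" "truncate A z = truncate A u" using z(1) by auto
        ultimately have "Some D \<in> U" by (metis truncate_eq_Some_iff)
        then show False using z(2) D(1) by simp
      qed
    qed (use UY in auto)
    then have "openin (quotient_topology Y (truncate A)) (truncate A ` U)"
      using U(1) UY by (auto simp: openin_quotient_topology)
    then show ?thesis using imageI[OF U(2)] equalityD1[OF pre] by (rule that[OF A])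
  qed
qed

text \<open>The bonding maps are continuous since a map out of a quotient is continuous once its
  composite with the quotient map is, and here that composite is again a truncation.\<close>

theorem theorem2:
  fixes X :: "'a set"
  shows "\<exists>(I :: 'a set set) (r :: 'a set rel) (T :: 'a set \<Rightarrow> 'a set option topology)
            (p :: 'a set \<Rightarrow> 'a set \<Rightarrow> 'a set option \<Rightarrow> 'a set option).
           inverse_system I r T p \<and>
           (\<forall>i\<in>I. finite (topspace (T i))) \<and>
           Alexandroff_compactification (finite_hyperspace X) homeomorphic_space inverse_limit I r T p"
proof -
  define Y where "Y = Alexandroff_compactification (finite_hyperspace X)"
  define I where "I = {A. finite A \<and> A \<subseteq> X}"
  define r where "r = {(A, B). A \<in> I \<and> B \<in> I \<and> A \<subseteq> B}"
  define T where "T = (\<lambda>A. quotient_topology Y (truncate A))"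
  define p :: "'a set \<Rightarrow> 'a set \<Rightarrow> 'a set option \<Rightarrow> 'a set option" where "p = (\<lambda>A B. truncate A)"
  have topY: "topspace Y = insert None (Some ` {C. C \<noteq> {} \<and> C \<in> I})"
    by (auto simp: Y_def topspace_Alexandroff_compactification topspace_finite_hyperspace I_def)
  have topT: "topspace (T A) = truncate A ` topspace Y" for A
    by (simp add: T_def topspace_quotient_topology)
  have quot: "quotient_map Y (T A) (truncate A)" for A
    by (simp add: T_def quotient_map_quotient_topology)
  have system: "inverse_system I r T p"
    unfolding inverse_system_def
  proof (intro conjI allI impI ballI)
    have "preorder_on I r"
      by (auto simp: preorder_on_def refl_on_def trans_def r_def)
    moreover have "A \<union> B \<in> I" if "A \<in> I" "B \<in> I" for A B
      using that by (auto simp: I_def)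
    moreover have "{} \<in> I" by (simp add: I_def)
    ultimately show "directed_set I r"
      unfolding directed_set_def r_def by blast
    fix A B assume "(A, B) \<in> r"
    then have "truncate A \<circ> truncate B = truncate A"
      by (auto simp: r_def truncate_truncate)
    then show "continuous_map (T B) (T A) (p A B)"
      using continuous_compose_quotient_map[OF quot] quotient_imp_continuous_map[OF quot]
      by (metis p_def)
  qed (auto simp: topT p_def r_def truncate_truncate)
  have fin: "finite (topspace (T A))" if "A \<in> I" for A
  proof (rule finite_subset)
    show "topspace (T A) \<subseteq> insert None (Some ` Pow A)"
      by (auto simp: topT truncate_def split: option.splits)
    show "finite (insert None (Some ` Pow A))" using that by (simp add: I_def)
  qed
  have "homeomorphic_map Y (inverse_limit I r T p) (\<lambda>y. \<lambda>A\<in>I. truncate A y)"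
  proof (rule homeomorphic_map_inverse_limit)
    show "r \<subseteq> I \<times> I" by (auto simp: r_def)
    show "continuous_map Y (T A) (truncate A)" for A
      using quot by (rule quotient_imp_continuous_map)
    show "p A B (truncate B y) = truncate A y" if "(A, B) \<in> r" for A B y
      using that by (simp add: p_def r_def truncate_truncate)
    show "\<exists>y\<in>topspace Y. \<forall>A\<in>I. truncate A y = x A"
      if "x \<in> topspace (inverse_limit I r T p)" for x
    proof (cases "\<exists>A\<in>I. x A \<noteq> None")
      case False
      then show ?thesis by (auto simp: topY)
    next
      case True
      then obtain A C where A: "A \<in> I" "x A = Some C" by blast
      have thread: "truncate B (x D) = x B" if "B \<in> I" "D \<in> I" "B \<subseteq> D" for B D
        using \<open>x \<in> _\<close> that by (auto simp: inverse_limit_def r_def p_def)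
      have "Some C \<in> topspace (T A)"
        using \<open>x \<in> _\<close> A by (force simp: inverse_limit_def)
      then have "Some C \<in> topspace Y"
        by (auto simp: topT truncate_eq_Some_iff eq_commute[of "Some C"])
      moreover have "truncate B (Some C) = x B" if "B \<in> I" for B
      proof -
        have D: "A \<union> B \<in> I" using A(1) that by (auto simp: I_def)
        then have "x (A \<union> B) = Some C"
          using thread[of A "A \<union> B"] A by (simp add: truncate_eq_Some_iff)
        then show ?thesis using thread[of B "A \<union> B"] D that by simp
      qed
      ultimately show ?thesis by blast
    qed
    show "y = z" if yz: "y \<in> topspace Y" "z \<in> topspace Y"
      and eq: "\<And>A. A \<in> I \<Longrightarrow> truncate A y = truncate A z" for y z
    proof -
      have *: "v = Some C" if "C \<in> I" "truncate C (Some C) = truncate C v" for v C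
        using that by (metis truncate_eq_Some_iff order_refl)
      show ?thesis
      proof (cases "y = None \<and> z = None")
        case False
        then obtain C where "C \<in> I" "y = Some C \<or> z = Some C"
          using yz by (auto simp: topY)
        then show ?thesis using *[of C] eq[of C] by metis
      qed simp
    qed
    show "\<exists>A\<in>I. \<exists>W. openin (T A) W \<and> truncate A y \<in> W \<and> {z \<in> topspace Y. truncate A z \<in> W} \<subseteq> U"
      if U: "openin Y U" "y \<in> U" for U y
    proof -
      obtain A W where "finite A" "A \<subseteq> X" "openin (T A) W"
          "truncate A y \<in> W" "{z \<in> topspace Y. truncate A z \<in> W} \<subseteq> U"
        using U unfolding Y_def T_def by (rule open_nbhd_from_truncation)
      then show ?thesis unfolding I_def by blast
    qed
  qed
  then have "Y homeomorphic_space inverse_limit I r T p"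
    by (rule homeomorphic_map_imp_homeomorphic_space)
  then show ?thesis using system fin unfolding Y_def by blast
qed

end
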